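(* Let $d\ge 1$ be an integer and let $\lambda>0$. Let $u=(u_j)_{j\in\mathbb{Z}^d}$ be a solution on $[0,1]$ of the free discrete Schr\"odinger equation $$\partial_t u_j=i\Delta_d u_j=i\sum_{k=1}^d(u_{j+e_k}-2u_j+u_{j-e_k}),\qquad j\in\mathbb{Z}^d,$$ such that $$\sum_{j\in\mathbb{Z}^d}e^{2\lambda|j|^2}|u_j(0)|^2+\sum_{j\in\mathbb{Z}^d}e^{2\lambda|j|^2}|u_j(1)|^2<+\infty.$$ Then $$G(t)=\sum_{j\in\mathbb{Z}^d}e^{2\lambda|j|^2}|u_j(t)|^2$$ is logarithmically convex on $[0,1]$.
   Context: $e_1,\dots,e_d$ is the standard basis of $\mathbb{Z}^d$ and $|j|$ is the Euclidean norm of $j$. A solution on $[0,1]$ means a complex-valued $u\in C([0,1];\ell^2(\mathbb{Z}^d))$ whose components satisfy the equation. A function $G:[0,1]\to[0,\infty)$ is logarithmically convex if $G((1-s)t_0+st_1)\le G(t_0)^{1-s}G(t_1)^s$ for all $t_0,t_1\in[0,1]$ and $s\in(0,1)$; in particular $G$ is finite on $[0,1]$. *)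

theory Defs
  imports "HOL-Analysis.Analysis"
begin

text \<open>The lattice \<open>\<int>\<^sup>d\<close> is the type \<^typ>\<open>int ^ 'd\<close> with \<open>d = CARD('d) \<ge> 1\<close>, and \<open>e\<^sub>k\<close> is
  \<^term>\<open>axis k 1 :: int ^ 'd\<close>. HOL-Analysis puts no norm on this type, so \<open>|j|\<close> is
  the library norm of the image of \<open>j\<close> in \<open>\<real>\<^sup>d\<close>.\<close>

definition lattice_norm :: "int ^ 'd \<Rightarrow> real" where
  "lattice_norm j = norm (\<chi> k. real_of_int (j $ k))"

definition discrete_laplacian :: "(int ^ 'd \<Rightarrow> complex) \<Rightarrow> int ^ 'd \<Rightarrow> complex" where
  "discrete_laplacian f j = (\<Sum>k\<in>UNIV. f (j + axis k 1) - 2 * f j + f (j - axis k 1))"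

definition ell2 :: "('a \<Rightarrow> complex) set" where
  "ell2 = {f. (\<lambda>j. (cmod (f j))\<^sup>2) summable_on UNIV}"

definition ell2_norm :: "('a \<Rightarrow> complex) \<Rightarrow> real" where
  "ell2_norm f = sqrt (\<Sum>\<^sub>\<infinity>j. (cmod (f j))\<^sup>2)"

definition continuous_on_ell2 :: "real set \<Rightarrow> (real \<Rightarrow> 'a \<Rightarrow> complex) \<Rightarrow> bool" where
  "continuous_on_ell2 S u \<longleftrightarrow>
     (\<forall>t\<in>S. u t \<in> ell2) \<and>
     (\<forall>t\<in>S. ((\<lambda>r. ell2_norm (\<lambda>j. u r j - u t j)) \<longlongrightarrow> 0) (at t within S))"

text \<open>The time derivative is one-sided at the endpoints 0 and 1.\<close>

definition free_schroedinger_solution :: "(real \<Rightarrow> int ^ 'd \<Rightarrow> complex) \<Rightarrow> bool" where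
  "free_schroedinger_solution u \<longleftrightarrow>
     continuous_on_ell2 {0..1} u \<and>
     (\<forall>t\<in>{0..1}. \<forall>j.
        ((\<lambda>r. u r j) has_vector_derivative \<i> * discrete_laplacian (u t) j) (at t within {0..1}))"

definition gauss_density :: "real \<Rightarrow> (int ^ 'd \<Rightarrow> complex) \<Rightarrow> int ^ 'd \<Rightarrow> real" where
  "gauss_density lam f j = exp (2 * lam * (lattice_norm j)\<^sup>2) * (cmod (f j))\<^sup>2"

text \<open>Finiteness of the values is built into the codomain \<^typ>\<open>real\<close>. For a function given by an
  infinite sum, which \<^const>\<open>infsum\<close> sets to 0 when it diverges, summability has to be stated
  separately. The exponents are positive, so \<open>0 powr a = 0\<close> is the intended value.\<close>

definition log_convex_unit :: "(real \<Rightarrow> real) \<Rightarrow> bool" where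
  "log_convex_unit G \<longleftrightarrow>
     (\<forall>t\<in>{0..1}. 0 \<le> G t) \<and>
     (\<forall>t0\<in>{0..1}. \<forall>t1\<in>{0..1}. \<forall>s\<in>{0<..<1}.
        G ((1 - s) * t0 + s * t1) \<le> G t0 powr (1 - s) * G t1 powr s)"

end

theory Submission
  imports Defs "HOL-Real_Asymp.Real_Asymp"
begin

text \<open>Gaussian decay of \<open>u(0)\<close> makes the generating function \<open>U(z, t) = \<Sum>\<^sub>j e\<^bsup>z\<cdot>j\<^esup> u\<^sub>j(t)\<close>
  converge for all complex \<open>z\<close>, and the equation becomes
  \<open>U(z, t) = e\<^bsup>i t m(z)\<^esup> U(z, 0)\<close> with \<open>m(z) = \<Sum>\<^sub>k (e\<^bsup>-z\<^sub>k\<^esup> - 2 + e\<^bsup>z\<^sub>k\<^esup>)\<close>. Hence \<open>|U(z, t)|\<^sup>2\<close>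
  is an exponential in \<open>t\<close>, so it satisfies every inequality
  \<open>F(r) \<le> \<alpha> F(t\<^sub>0) + \<beta> F(t\<^sub>1)\<close> that all real exponentials satisfy. Such inequalities are linear in \<open>F\<close>, so they
  survive the Plancherel identity, which turns \<open>|U(y/2 + i\<theta>, t)|\<^sup>2\<close> averaged over \<open>\<theta>\<close> into
  \<open>\<Sum>\<^sub>j e\<^bsup>y\<cdot>j\<^esup> |u\<^sub>j(t)|\<^sup>2\<close>, and positive combinations of these over \<open>y\<close>. The Gaussian weight is
  the limit, from below, of the combinations \<open>\<Prod>\<^sub>k cosh(2 j\<^sub>k (\<lambda>/n)\<^bsup>1/2\<^esup>)\<^bsup>n\<^esup>\<close>. Taking the coefficients of the weighted
  arithmetic-geometric mean inequality with a free scaling parameter and optimizing over it gives logarithmic convexity.\<close>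

section \<open>Exponential weights and the discrete Laplacian\<close>

text \<open>The exponent is complex: its real part supplies a weight, its imaginary part a Fourier
  character.\<close>

definition lat_exp :: "('d::finite \<Rightarrow> complex) \<Rightarrow> int ^ 'd \<Rightarrow> complex" where
  "lat_exp z j = exp (\<Sum>k\<in>UNIV. z k * of_int (j $ k))"

lemma lat_exp_add: "lat_exp z (i + j) = lat_exp z i * lat_exp z j"
  by (simp add: lat_exp_def algebra_simps sum.distrib exp_add)

lemma lat_exp_diff: "lat_exp z (i - j) = lat_exp z i / lat_exp z j"
  by (simp add: lat_exp_def algebra_simps sum_subtractf exp_diff)

lemma lat_exp_axis: "lat_exp z (axis k 1) = exp (z k)"
proof -
  have "(\<Sum>l\<in>UNIV. z l * of_int (axis k 1 $ l)) = (\<Sum>l\<in>UNIV. if l = k then z l else 0)"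
    by (intro sum.cong) (auto simp: axis_def)
  then show ?thesis by (simp add: lat_exp_def)
qed

lemma norm_lat_exp: "cmod (lat_exp z j) = exp (\<Sum>k\<in>UNIV. Re (z k) * of_int (j $ k))"
  by (simp add: lat_exp_def)

lemma lat_exp_plus: "lat_exp (\<lambda>k. z k + w k) j = lat_exp z j * lat_exp w j"
  by (simp add: lat_exp_def algebra_simps sum.distrib exp_add)

text \<open>The Fourier multiplier of the discrete Laplacian at complex frequency; each summand is
  \<open>2 * cosh (z k) - 2\<close>.\<close>

definition lap_symbol :: "('d::finite \<Rightarrow> complex) \<Rightarrow> complex" where
  "lap_symbol z = (\<Sum>k\<in>UNIV. exp (- z k) - 2 + exp (z k))"

section \<open>Translation invariance and the Laplacian under exponential weights\<close>

lemma has_sum_translate: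
  fixes g :: "'a::ab_group_add \<Rightarrow> 'b::{comm_monoid_add,topological_space}"
  assumes "(g has_sum S) UNIV"
  shows "((\<lambda>j. g (j + e)) has_sum S) UNIV" "((\<lambda>j. g (j - e)) has_sum S) UNIV"
proof -
  have "bij (\<lambda>j. j + e)" "bij (\<lambda>j. j - e)"
    by (rule bij_betw_byWitness[where f' = "\<lambda>j. j - e"]; simp)
       (rule bij_betw_byWitness[where f' = "\<lambda>j. j + e"]; simp)
  then show "((\<lambda>j. g (j + e)) has_sum S) UNIV" "((\<lambda>j. g (j - e)) has_sum S) UNIV"
    using assms by (simp_all add: has_sum_reindex_bij_betw[where g = "\<lambda>j. j + e"]
        has_sum_reindex_bij_betw[where g = "\<lambda>j. j - e"])
qed

lemma has_sum_sum:
  fixes f :: "'i \<Rightarrow> 'a \<Rightarrow> 'b::topological_comm_monoid_add"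
  assumes "\<And>i. i \<in> I \<Longrightarrow> (f i has_sum S i) A"
  shows "((\<lambda>x. \<Sum>i\<in>I. f i x) has_sum (\<Sum>i\<in>I. S i)) A"
  using assms by (induction I rule: infinite_finite_induct) (auto intro: has_sum_add)

text \<open>Moving the weight to a neighbouring site costs only a constant factor, so each value of
  \<open>f\<close> meets the weight of its own site.\<close>

lemma lat_exp_laplacian:
  fixes f :: "int ^ 'd \<Rightarrow> complex"
  shows "lat_exp z j * discrete_laplacian f j =
    (\<Sum>k\<in>UNIV. exp (- z k) * (lat_exp z (j + axis k 1) * f (j + axis k 1))
       - 2 * (lat_exp z j * f j)
       + exp (z k) * (lat_exp z (j - axis k 1) * f (j - axis k 1)))"
  unfolding discrete_laplacian_def sum_distrib_left
  by (intro sum.cong)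
     (simp_all add: lat_exp_add lat_exp_diff lat_exp_axis algebra_simps exp_minus)

text \<open>Translated series have the same sum, so only the constant factors remain, and they add
  up to the symbol.\<close>

lemma has_sum_laplacian:
  fixes f :: "int ^ 'd \<Rightarrow> complex"
  assumes "((\<lambda>j. lat_exp z j * f j) has_sum S) UNIV"
  shows "((\<lambda>j. lat_exp z j * discrete_laplacian f j) has_sum (lap_symbol z * S)) UNIV"
proof -
  have "((\<lambda>j. lat_exp z j * discrete_laplacian f j) has_sum
      (\<Sum>k\<in>UNIV. exp (- z k) * S - 2 * S + exp (z k) * S)) UNIV"
    unfolding lat_exp_laplacian diff_conv_add_uminus
    using has_sum_translate[OF assms] assms
    by (intro has_sum_sum has_sum_add has_sum_uminusI has_sum_cmult_right) auto
  then show ?thesis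
    by (simp add: lap_symbol_def sum_distrib_right distrib_right left_diff_distrib)
qed

text \<open>The symbol with every term replaced by its modulus; it bounds the Laplacian on the
  weighted l^1 space.\<close>

definition lap_bound :: "('d::finite \<Rightarrow> complex) \<Rightarrow> real" where
  "lap_bound z = (\<Sum>k\<in>UNIV. exp (- Re (z k)) + 2 + exp (Re (z k)))"

lemma lap_bound_nonneg: "0 \<le> lap_bound z"
  by (auto simp: lap_bound_def intro!: sum_nonneg add_nonneg_nonneg)

text \<open>The triangle inequality reduces this to translates of one convergent series. A free
  bound \<open>A\<close> in place of the sum lets the estimate be iterated.\<close>

lemma abs_summable_laplacian:
  fixes f :: "int ^ 'd \<Rightarrow> complex"
  assumes "(\<lambda>j. cmod (lat_exp z j * f j)) summable_on UNIV"
    and "(\<Sum>\<^sub>\<infinity>j. cmod (lat_exp z j * f j)) \<le> A"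
  shows "(\<lambda>j. cmod (lat_exp z j * discrete_laplacian f j)) summable_on UNIV"
    and "(\<Sum>\<^sub>\<infinity>j. cmod (lat_exp z j * discrete_laplacian f j)) \<le> lap_bound z * A"
proof -
  define a where "a j = cmod (lat_exp z j * f j)" for j
  define S where "S = (\<Sum>\<^sub>\<infinity>j. a j)"
  have a: "(a has_sum S) UNIV"
    using has_sum_infsum[OF assms(1)] by (simp add: a_def[abs_def] S_def)
  define b where "b j = (\<Sum>k\<in>UNIV. exp (- Re (z k)) * a (j + axis k 1)
       + 2 * a j + exp (Re (z k)) * a (j - axis k 1))" for j
  have "(b has_sum (\<Sum>k\<in>UNIV. exp (- Re (z k)) * S + 2 * S + exp (Re (z k)) * S)) UNIV"
    unfolding b_def using has_sum_translate[OF a] a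
    by (intro has_sum_sum has_sum_add has_sum_cmult_right) auto
  then have b: "(b has_sum (lap_bound z * S)) UNIV"
    by (simp add: lap_bound_def sum_distrib_right distrib_right)
  have le: "cmod (lat_exp z j * discrete_laplacian f j) \<le> b j" for j
    unfolding b_def lat_exp_laplacian
    by (intro sum_norm_le order_trans[OF norm_triangle_ineq] add_mono
        order_trans[OF norm_triangle_ineq4]) (simp_all add: norm_mult a_def)
  show s: "(\<lambda>j. cmod (lat_exp z j * discrete_laplacian f j)) summable_on UNIV"
    by (rule summable_on_comparison_test[OF has_sum_imp_summable[OF b] le]) simp
  have "(\<Sum>\<^sub>\<infinity>j. cmod (lat_exp z j * discrete_laplacian f j)) \<le> lap_bound z * S"
    by (rule has_sum_mono[OF has_sum_infsum[OF s] b le])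
  also have "\<dots> \<le> lap_bound z * A"
    using assms(2) by (auto simp: S_def a_def intro!: mult_left_mono lap_bound_nonneg)
  finally show "(\<Sum>\<^sub>\<infinity>j. cmod (lat_exp z j * discrete_laplacian f j)) \<le> lap_bound z * A" .
qed

text \<open>Growth in \<open>n\<close> is only geometric, so the factorials of the time expansion
  will make the double series converge absolutely.\<close>

lemma abs_summable_laplacian_power:
  fixes f :: "int ^ 'd \<Rightarrow> complex"
  assumes "(\<lambda>j. cmod (lat_exp z j * f j)) summable_on UNIV"
  shows "(\<lambda>j. cmod (lat_exp z j * (discrete_laplacian ^^ n) f j)) summable_on UNIV \<and>
    (\<Sum>\<^sub>\<infinity>j. cmod (lat_exp z j * (discrete_laplacian ^^ n) f j))
      \<le> lap_bound z ^ n * (\<Sum>\<^sub>\<infinity>j. cmod (lat_exp z j * f j))"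
proof (induction n)
  case (Suc n)
  then show ?case
    using abs_summable_laplacian[of z "(discrete_laplacian ^^ n) f"]
    by (auto simp: mult.assoc)
qed (use assms in simp)

lemma has_sum_laplacian_power:
  fixes f :: "int ^ 'd \<Rightarrow> complex"
  assumes "((\<lambda>j. lat_exp z j * f j) has_sum S) UNIV"
  shows "((\<lambda>j. lat_exp z j * (discrete_laplacian ^^ n) f j) has_sum (lap_symbol z ^ n * S)) UNIV"
proof (induction n)
  case (Suc n)
  from has_sum_laplacian[OF this] show ?case
    by (simp add: mult.assoc)
qed (use assms in simp)

section \<open>Taylor expansion of solutions in time\<close>

text \<open>One term of the sum of squares is at most the whole sum. Summability of the difference
  has to be shown first, since a divergent \<open>infsum\<close> is 0.\<close>

lemma cmod_le_ell2_norm_diff: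
  fixes f g :: "'a \<Rightarrow> complex"
  assumes "f \<in> ell2" "g \<in> ell2"
  shows "cmod (f j - g j) \<le> ell2_norm (\<lambda>j. f j - g j)"
proof -
  have "(\<lambda>j. 2 * (cmod (f j))\<^sup>2 + 2 * (cmod (g j))\<^sup>2) summable_on UNIV"
    using assms by (intro summable_on_add summable_on_cmult_right) (auto simp: ell2_def)
  moreover have "(cmod (f j - g j))\<^sup>2 \<le> 2 * (cmod (f j))\<^sup>2 + 2 * (cmod (g j))\<^sup>2" for j
  proof -
    have "(cmod (f j - g j))\<^sup>2 \<le> (cmod (f j) + cmod (g j))\<^sup>2"
      by (intro power_mono norm_triangle_ineq4) auto
    also have "\<dots> \<le> 2 * (cmod (f j))\<^sup>2 + 2 * (cmod (g j))\<^sup>2"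
      using sum_squares_bound[of "cmod (f j)" "cmod (g j)"] by (simp add: power2_sum)
    finally show ?thesis .
  qed
  ultimately have "(\<lambda>j. (cmod (f j - g j))\<^sup>2) summable_on UNIV"
    by (rule summable_on_comparison_test) auto
  from finite_sum_le_infsum[OF this, of "{j}"]
  have "(cmod (f j - g j))\<^sup>2 \<le> (\<Sum>\<^sub>\<infinity>j. (cmod (f j - g j))\<^sup>2)" by simp
  then show ?thesis
    unfolding ell2_norm_def by (rule real_le_rsqrt)
qed

lemma ell2_bounded:
  fixes f :: "'a \<Rightarrow> complex"
  assumes "f \<in> ell2"
  obtains B where "\<And>j. cmod (f j) \<le> B"
proof -
  have "(\<lambda>j. 0) \<in> (ell2 :: ('a \<Rightarrow> complex) set)" by (simp add: ell2_def)
  from cmod_le_ell2_norm_diff[OF assms this] show ?thesis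
    by (intro that[of "ell2_norm f"]) simp
qed

text \<open>Continuity in l^2 bounds \<open>u\<close> near each time, uniformly over the lattice;
  bisection of the compact interval makes the bound uniform in time.\<close>

lemma continuous_on_ell2_bounded:
  fixes u :: "real \<Rightarrow> 'a \<Rightarrow> complex"
  assumes "continuous_on_ell2 {a..b} u" "a \<le> b"
  obtains M where "\<And>t j. t \<in> {a..b} \<Longrightarrow> cmod (u t j) \<le> M"
proof -
  define P where "P x y \<longleftrightarrow> (\<exists>M. \<forall>t\<in>{x..y} \<inter> {a..b}. \<forall>j. cmod (u t j) \<le> M)" for x y
  have "P a b" using \<open>a \<le> b\<close>
  proof (induction rule: Bolzano)
    case (trans x y w)
    then obtain M1 M2 where "\<forall>t\<in>{x..y} \<inter> {a..b}. \<forall>j. cmod (u t j) \<le> M1"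
      "\<forall>t\<in>{y..w} \<inter> {a..b}. \<forall>j. cmod (u t j) \<le> M2" unfolding P_def by blast
    then have "cmod (u t j) \<le> max M1 M2" if "t \<in> {x..w} \<inter> {a..b}" for t j
      using that by (cases "t \<le> y") (auto simp: le_max_iff_disj)
    then show ?case unfolding P_def by blast
  next
    case (local x)
    have x: "x \<in> {a..b}" using local by simp
    then have "((\<lambda>r. ell2_norm (\<lambda>j. u r j - u x j)) \<longlongrightarrow> 0) (at x within {a..b})"
      using assms by (auto simp: continuous_on_ell2_def)
    then have "eventually (\<lambda>r. ell2_norm (\<lambda>j. u r j - u x j) < 1) (at x within {a..b})"
      by (rule order_tendstoD) simp
    then obtain d where d: "d > 0"
      "\<And>r. r \<in> {a..b} \<Longrightarrow> r \<noteq> x \<Longrightarrow> dist r x < d \<Longrightarrow> ell2_norm (\<lambda>j. u r j - u x j) < 1"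
      unfolding eventually_at by auto
    have u: "u r \<in> ell2" if "r \<in> {a..b}" for r
      using assms that by (auto simp: continuous_on_ell2_def)
    obtain B where B: "\<And>j. cmod (u x j) \<le> B" using ell2_bounded[OF u[OF x]] by metis
    have bd: "cmod (u r j) \<le> B + 1" if "r \<in> {a..b}" "dist r x < d" for r j
    proof (cases "r = x")
      case False
      then have "cmod (u r j - u x j) < 1"
        using d(2)[OF that(1) False that(2)] cmod_le_ell2_norm_diff[OF u[OF that(1)] u[OF x], of j]
        by simp
      then show ?thesis
        using B[of j] norm_triangle_ineq[of "u r j - u x j" "u x j"] by simp
    qed (use B[of j] in simp)
    show ?case
    proof (intro exI[of _ d] conjI allI impI d(1))
      fix y w assume "y \<le> x \<and> x \<le> w \<and> w - y < d"
      then have "dist r x < d" if "r \<in> {y..w}" for r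
        using that by (auto simp: dist_real_def)
      then show "P y w" using bd unfolding P_def by blast
    qed
  qed
  then obtain M where "\<forall>t\<in>{a..b}. \<forall>j. cmod (u t j) \<le> M" unfolding P_def by auto
  then show ?thesis by (intro that[of M]) auto
qed

section \<open>Iterated Laplacians and the Taylor series in time\<close>

lemma cmod_laplacian_power_le:
  fixes f :: "int ^ 'd \<Rightarrow> complex"
  assumes "\<And>j. cmod (f j) \<le> M"
  shows "cmod ((discrete_laplacian ^^ n) f j) \<le> (4 * real CARD('d)) ^ n * M"
proof (induction n arbitrary: j)
  case (Suc n)
  let ?g = "(discrete_laplacian ^^ n) f" and ?K = "(4 * real CARD('d)) ^ n * M"
  have "cmod (discrete_laplacian ?g j) \<le> (\<Sum>k\<in>(UNIV::'d set). 4 * ?K)"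
    unfolding discrete_laplacian_def[of ?g]
  proof (rule sum_norm_le)
    fix k :: 'd
    \<comment> \<open>The 4 is \<open>1 + 2 + 1\<close>, the moduli of the coefficients of the
      second difference in one direction.\<close>
    show "cmod (?g (j + axis k 1) - 2 * ?g j + ?g (j - axis k 1)) \<le> 4 * ?K"
      using Suc[of "j + axis k 1"] Suc[of j] Suc[of "j - axis k 1"]
        norm_triangle_ineq[of "?g (j + axis k 1) - 2 * ?g j" "?g (j - axis k 1)"]
        norm_triangle_ineq4[of "?g (j + axis k 1)" "2 * ?g j"]
      by (simp add: norm_mult)
  qed
  then show ?case by (simp add: mult_ac)
qed (use assms in simp)

text \<open>The Laplacian is a finite linear combination of components, so it commutes with the time
  derivative.\<close>

lemma vector_derivative_laplacian_power:
  fixes u :: "real \<Rightarrow> int ^ 'd \<Rightarrow> complex"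
  assumes "\<And>j. ((\<lambda>r. u r j) has_vector_derivative \<i> * discrete_laplacian (u t) j) (at t within S)"
  shows "((\<lambda>r. \<i> ^ n * (discrete_laplacian ^^ n) (u r) j) has_vector_derivative
     \<i> ^ Suc n * (discrete_laplacian ^^ Suc n) (u t) j) (at t within S)"
proof -
  have "((\<lambda>r. (discrete_laplacian ^^ n) (u r) j) has_vector_derivative
     \<i> * (discrete_laplacian ^^ Suc n) (u t) j) (at t within S)"
  proof (induction n arbitrary: j)
    case (Suc n)
    let ?g = "\<lambda>r. (discrete_laplacian ^^ n) (u r)"
    have "((\<lambda>r. discrete_laplacian (?g r) j) has_vector_derivative
        discrete_laplacian (\<lambda>j. \<i> * (discrete_laplacian ^^ Suc n) (u t) j) j) (at t within S)"
      unfolding discrete_laplacian_def[of "?g _"]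
        discrete_laplacian_def[of "\<lambda>j. \<i> * (discrete_laplacian ^^ Suc n) (u t) j"]
      by (intro derivative_intros has_vector_derivative_mult_right Suc)
    also have "discrete_laplacian (\<lambda>j. \<i> * (discrete_laplacian ^^ Suc n) (u t) j) j
        = \<i> * discrete_laplacian ((discrete_laplacian ^^ Suc n) (u t)) j"
      unfolding discrete_laplacian_def[of "\<lambda>j. \<i> * _ j"]
        discrete_laplacian_def[of "(discrete_laplacian ^^ Suc n) (u t)"]
      by (simp add: sum_distrib_left algebra_simps)
    finally show ?case by simp
  qed (use assms in simp)
  from has_vector_derivative_mult_right[OF this, of "\<i> ^ n"] show ?thesis
    by (simp add: mult_ac)
qed

text \<open>Derivatives of geometric growth lose against the factorial in the Taylor remainder.
  Taylor's theorem is applied on the closed interval, with one-sided derivatives at its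
  ends.\<close>

lemma real_taylor_sums:
  fixes F :: "nat \<Rightarrow> real \<Rightarrow> real"
  assumes der: "\<And>n x. x \<in> {0..1} \<Longrightarrow> (F n has_real_derivative F (Suc n) x) (at x within {0..1})"
    and bound: "\<And>n x. x \<in> {0..1} \<Longrightarrow> \<bar>F n x\<bar> \<le> K ^ n * M"
    and t: "t \<in> {0..1}"
  shows "(\<lambda>n. F n 0 * t ^ n / fact n) sums F 0 t"
proof -
  have le: "norm (F 0 t - (\<Sum>i\<le>n. F i 0 * t ^ i / fact i)) \<le> K * M * (K ^ n / fact n)" for n
  proof -
    \<comment> \<open>The sign comes from \<open>bound\<close>, whose left side is an absolute
      value.\<close>
    have KM: "0 \<le> K ^ Suc n * M" using bound[of 0 "Suc n"] by simp
    have "norm (F 0 t - (\<Sum>i\<le>n. F i 0 * (t - 0) ^ i / fact i))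
        \<le> K ^ Suc n * M * norm (t - 0) ^ Suc n / fact n"
      by (rule field_Taylor[of "{0..1}"]) (use der bound[of _ "Suc n"] t in auto)
    also have "\<dots> \<le> K ^ Suc n * M * 1 / fact n"
      using t KM by (intro divide_right_mono mult_left_mono power_le_one) auto
    finally show ?thesis by (simp add: mult_ac)
  qed
  have "(\<lambda>n. K * M * (K ^ n / fact n)) \<longlonglongrightarrow> K * M * 0"
    using summable_LIMSEQ_zero[OF summable_exp[of K]]
    by (intro tendsto_mult tendsto_const) (simp add: field_simps)
  then have "(\<lambda>n. K * M * (K ^ n / fact n)) \<longlonglongrightarrow> 0" by simp
  then have "(\<lambda>n. F 0 t - (\<Sum>i\<le>n. F i 0 * t ^ i / fact i)) \<longlonglongrightarrow> 0"
    by (rule Lim_null_comparison[OF always_eventually[OF allI[OF le]]])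
  from tendsto_diff[OF tendsto_const[of "F 0 t"] this] show ?thesis
    by (simp add: sums_def_le)
qed

text \<open>The Laplacian is a bounded operator on bounded sequences, so a bounded solution is the
  exponential series applied to its initial value.\<close>

lemma solution_taylor_sums:
  fixes u :: "real \<Rightarrow> int ^ 'd \<Rightarrow> complex"
  assumes sol: "free_schroedinger_solution u" and t: "t \<in> {0..1}"
  shows "(\<lambda>n. (\<i> * of_real t) ^ n / fact n * (discrete_laplacian ^^ n) (u 0) j) sums u t j"
proof -
  obtain M where M: "\<And>t j. t \<in> {0..1} \<Longrightarrow> cmod (u t j) \<le> M"
    using continuous_on_ell2_bounded[of 0 1 u] sol by (auto simp: free_schroedinger_solution_def)
  define G where "G n r = \<i> ^ n * (discrete_laplacian ^^ n) (u r) j" for n r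
  have G: "(G n has_vector_derivative G (Suc n) x) (at x within {0..1})" if "x \<in> {0..1}" for n x
    unfolding G_def
    by (rule vector_derivative_laplacian_power)
       (use sol that in \<open>auto simp: free_schroedinger_solution_def\<close>)
  have bound: "cmod (G n x) \<le> (4 * real CARD('d)) ^ n * M" if "x \<in> {0..1}" for n x
    using cmod_laplacian_power_le[of "u x" M n j] M that by (simp add: G_def norm_mult norm_power)
  \<comment> \<open>The Taylor lemma concerns real functions, so real and imaginary parts are
    expanded separately.\<close>
  have "(\<lambda>n. Re (G n 0) * t ^ n / fact n) sums Re (G 0 t)"
  proof (rule real_taylor_sums[OF _ _ t])
    show "\<bar>Re (G n x)\<bar> \<le> (4 * real CARD('d)) ^ n * M" if "x \<in> {0..1}" for n x
      using bound[OF that] abs_Re_le_cmod order_trans by blast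
  qed (rule has_field_derivative_Re[OF G])
  moreover have "(\<lambda>n. Im (G n 0) * t ^ n / fact n) sums Im (G 0 t)"
  proof (rule real_taylor_sums[OF _ _ t])
    show "\<bar>Im (G n x)\<bar> \<le> (4 * real CARD('d)) ^ n * M" if "x \<in> {0..1}" for n x
      using bound[OF that] abs_Im_le_cmod order_trans by blast
  qed (rule has_field_derivative_Im[OF G])
  moreover define c where "c n = t ^ n / fact n" for n
  ultimately have "(\<lambda>n. c n * Re (G n 0)) sums Re (G 0 t)" "(\<lambda>n. c n * Im (G n 0)) sums Im (G 0 t)"
    by (simp_all add: mult_ac)
  then have "(\<lambda>n. complex_of_real (c n) * G n 0) sums G 0 t"
    by (simp add: sums_complex_iff)
  moreover have "complex_of_real (c n) * G n 0
      = (\<i> * of_real t) ^ n / fact n * (discrete_laplacian ^^ n) (u 0) j" for n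
    by (simp add: c_def G_def power_mult_distrib)
  moreover have "G 0 t = u t j" by (simp add: G_def)
  ultimately show ?thesis by simp
qed

section \<open>Plancherel comparison on the lattice\<close>

definition gen_fun :: "(int ^ 'd \<Rightarrow> complex) \<Rightarrow> ('d \<Rightarrow> complex) \<Rightarrow> complex" where
  "gen_fun f z = (\<Sum>\<^sub>\<infinity>j. lat_exp z j * f j)"

section \<open>Orthogonality of characters on a finite grid\<close>

lemma sum_roots_of_unity:
  fixes a :: int and n :: nat
  assumes "n > 0"
  shows "(\<Sum>m<n. exp (\<i> * of_real (2 * pi * m / n) * of_int a)) = (if int n dvd a then of_nat n else 0)"
proof -
  \<comment> \<open>The sum is geometric with ratio \<open>w\<close>, and \<open>w ^ n = 1\<close>;
    it vanishes unless \<open>w = 1\<close>, that is, unless \<open>n\<close> divides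
    \<open>a\<close>.\<close>
  define w where "w = exp (\<i> * of_real (2 * pi * of_int a / n))"
  have w: "exp (\<i> * of_real (2 * pi * m / n) * of_int a) = w ^ m" for m :: nat
    unfolding w_def exp_of_nat_mult[symmetric] by (rule arg_cong[of _ _ exp]) (simp add: field_simps)
  have "w ^ n = exp (\<i> * of_real (2 * pi * of_int a))"
    using assms unfolding w_def exp_of_nat_mult[symmetric] by (intro arg_cong[of _ _ exp]) simp
  also have "\<dots> = 1"
    unfolding exp_eq_1 by (auto intro!: exI[of _ a])
  finally have wn: "w ^ n = 1" .
  have "w = 1 \<longleftrightarrow> int n dvd a"
  proof -
    have "w = 1 \<longleftrightarrow> (\<exists>m::int. 2 * pi * of_int a / n = of_int (2 * m) * pi)"
      unfolding w_def exp_eq_1 by simp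
    also have "\<dots> \<longleftrightarrow> (\<exists>m::int. real_of_int a = of_int (int n * m))"
      using assms by (simp add: field_simps)
    also have "\<dots> \<longleftrightarrow> int n dvd a"
      unfolding of_int_eq_iff dvd_def ..
    finally show ?thesis .
  qed
  moreover have "(\<Sum>m<n. w ^ m) = 0" if "w \<noteq> 1"
    using geometric_sum[OF that, of n] wn by simp
  ultimately show ?thesis unfolding w by (cases "w = 1") auto
qed

definition torus_grid :: "nat \<Rightarrow> ('d \<Rightarrow> nat) set" where
  "torus_grid n = (UNIV \<rightarrow>\<^sub>E {..<n})"

definition grid_angle :: "nat \<Rightarrow> ('d \<Rightarrow> nat) \<Rightarrow> 'd \<Rightarrow> real" where
  "grid_angle n x k = 2 * pi * real (x k) / real n"

text \<open>The grid sum factorizes into one sum of roots of unity per coordinate. A coordinate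
  smaller than \<open>n\<close> in modulus is divisible by \<open>n\<close> only if it is 0.\<close>

lemma sum_lat_exp_grid:
  fixes j :: "int ^ 'd"
  assumes "n > 0" "\<And>k. \<bar>j $ k\<bar> < int n"
  shows "(\<Sum>x\<in>torus_grid n. lat_exp (\<lambda>k. \<i> * of_real (grid_angle n x k)) j)
    = (if j = 0 then of_nat n ^ CARD('d) else 0)"
proof -
  have "(\<Sum>x\<in>torus_grid n. lat_exp (\<lambda>k. \<i> * of_real (grid_angle n x k)) j)
     = (\<Sum>x\<in>UNIV \<rightarrow>\<^sub>E {..<n}. \<Prod>k\<in>UNIV. exp (\<i> * of_real (2 * pi * real (x k) / real n) * of_int (j $ k)))"
    by (simp add: torus_grid_def lat_exp_def exp_sum grid_angle_def)
  also have "\<dots> = (\<Prod>k\<in>UNIV. \<Sum>m<n. exp (\<i> * of_real (2 * pi * real m / real n) * of_int (j $ k)))"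
    by (rule prod_sum_PiE[symmetric]) auto
  also have "\<dots> = (\<Prod>k\<in>UNIV. if j $ k = 0 then of_nat n else 0)"
  proof (rule prod.cong[OF refl])
    fix k
    have "int n dvd j $ k \<longleftrightarrow> j $ k = 0"
      using zdvd_not_zless[of "\<bar>j $ k\<bar>" "int n"] assms(2)[of k] by auto
    then show "(\<Sum>m<n. exp (\<i> * of_real (2 * pi * real m / real n) * of_int (j $ k)))
      = (if j $ k = 0 then of_nat n else 0)"
      by (simp only: sum_roots_of_unity[OF assms(1)])
  qed
  also have "\<dots> = (if j = 0 then of_nat n ^ CARD('d) else 0)"
  proof (cases "j = 0")
    case False
    then obtain k where "j $ k \<noteq> 0" by (auto simp: vec_eq_iff)
    then have "(\<Prod>k\<in>UNIV. if j $ k = 0 then of_nat n else 0) = (0::complex)"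
      by (intro prod_zero) auto
    then show ?thesis using False by simp
  qed simp
  finally show ?thesis .
qed

text \<open>Expanding the square leaves character sums at the differences \<open>j - l\<close>.
  Coordinate differences below \<open>n\<close> rule out aliasing, so only the diagonal
  survives.\<close>

lemma finite_parseval:
  fixes f :: "int ^ 'd \<Rightarrow> complex"
  assumes "finite F" "n > 0" "\<And>j l k. j \<in> F \<Longrightarrow> l \<in> F \<Longrightarrow> \<bar>j $ k - l $ k\<bar> < int n"
  shows "(\<Sum>x\<in>torus_grid n. (cmod (\<Sum>j\<in>F. lat_exp (\<lambda>k. \<i> * of_real (grid_angle n x k)) j * f j))\<^sup>2)
    = real n ^ CARD('d) * (\<Sum>j\<in>F. (cmod (f j))\<^sup>2)"
proof -
  define e where "e x = lat_exp (\<lambda>k. \<i> * of_real (grid_angle n x k))" for x :: "'d \<Rightarrow> nat"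
  have cnj_e: "e x j * cnj (e x l) = e x (j - l)" for x j l
    by (simp add: e_def lat_exp_diff) (simp add: lat_exp_def exp_cnj exp_minus[symmetric] divide_inverse sum_negf)
  have "complex_of_real (\<Sum>x\<in>torus_grid n. (cmod (\<Sum>j\<in>F. e x j * f j))\<^sup>2)
      = (\<Sum>x\<in>torus_grid n. \<Sum>j\<in>F. \<Sum>l\<in>F. (f j * cnj (f l)) * e x (j - l))"
    unfolding of_real_sum complex_norm_square cnj_sum complex_cnj_mult sum_product
    by (intro sum.cong refl) (simp add: cnj_e[symmetric] mult_ac)
  also have "\<dots> = (\<Sum>j\<in>F. \<Sum>l\<in>F. (f j * cnj (f l)) * (\<Sum>x\<in>torus_grid n. e x (j - l)))"
    by (simp add: sum.swap[of _ F "torus_grid n"] sum_distrib_left)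
  also have "\<dots> = (\<Sum>j\<in>F. \<Sum>l\<in>F. if l = j then f j * cnj (f l) * of_nat n ^ CARD('d) else 0)"
  proof (intro sum.cong refl)
    fix j l assume "j \<in> F" "l \<in> F"
    then have "(\<Sum>x\<in>torus_grid n. e x (j - l)) = (if j - l = 0 then of_nat n ^ CARD('d) else 0)"
      unfolding e_def by (intro sum_lat_exp_grid assms(2)) (use assms(3) in auto)
    then show "(f j * cnj (f l)) * (\<Sum>x\<in>torus_grid n. e x (j - l))
      = (if l = j then f j * cnj (f l) * of_nat n ^ CARD('d) else 0)" by simp
  qed
  also have "\<dots> = complex_of_real (real n ^ CARD('d) * (\<Sum>j\<in>F. (cmod (f j))\<^sup>2))"
    using assms(1) unfolding of_real_mult of_real_sum complex_norm_square
    by (simp add: sum_distrib_left mult_ac)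
  finally show ?thesis unfolding of_real_eq_iff e_def .
qed

section \<open>Truncation to finite sets and the Plancherel comparison\<close>

lemma summable_on_squares:
  fixes f :: "'a \<Rightarrow> complex"
  assumes "(\<lambda>j. cmod (f j)) summable_on UNIV"
  shows "(\<lambda>j. (cmod (f j))\<^sup>2) summable_on UNIV"
proof (rule summable_on_comparison_test)
  show "(\<lambda>j. (\<Sum>\<^sub>\<infinity>j. cmod (f j)) * cmod (f j)) summable_on UNIV"
    using assms by (rule summable_on_cmult_right)
  fix j
  have "cmod (f j) \<le> (\<Sum>\<^sub>\<infinity>j. cmod (f j))"
    using finite_sum_le_infsum[OF assms, of "{j}"] by simp
  then show "(cmod (f j))\<^sup>2 \<le> (\<Sum>\<^sub>\<infinity>j. cmod (f j)) * cmod (f j)"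
    by (simp add: power2_eq_square mult_right_mono)
qed auto

text \<open>Characters have modulus 1, so the estimate is uniform in \<open>\<theta>\<close>. The
  difference of squares factors: the moduli differ by at most the tail, and their sum is at most
  \<open>2 * P\<close>.\<close>

lemma gen_fun_truncation:
  fixes f :: "int ^ 'd \<Rightarrow> complex" and \<theta> :: "'d \<Rightarrow> real"
  assumes f: "(\<lambda>j. cmod (f j)) summable_on UNIV" and F: "finite F"
  defines "P \<equiv> \<Sum>\<^sub>\<infinity>j. cmod (f j)"
  defines "z \<equiv> \<lambda>k. \<i> * of_real (\<theta> k)"
  shows "\<bar>(cmod (gen_fun f z))\<^sup>2 - (cmod (\<Sum>j\<in>F. lat_exp z j * f j))\<^sup>2\<bar>
    \<le> 2 * P * (P - (\<Sum>j\<in>F. cmod (f j)))"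
proof -
  let ?g = "\<lambda>j. lat_exp z j * f j"
  have g: "cmod (?g j) = cmod (f j)" for j
    by (simp add: norm_mult norm_lat_exp z_def)
  have sg: "(\<lambda>j. cmod (?g j)) summable_on A" for A
    unfolding g by (rule summable_on_subset_banach[OF f]) auto
  have split: "infsum ?g UNIV = sum ?g F + infsum ?g (- F)"
    "P = (\<Sum>j\<in>F. cmod (f j)) + (\<Sum>\<^sub>\<infinity>j\<in>-F. cmod (f j))"
    using infsum_Un_disjoint[of ?g F "- F"] infsum_Un_disjoint[of "\<lambda>j. cmod (f j)" F "- F"] F
      abs_summable_summable[OF sg] sg[unfolded g] by (simp_all add: P_def)
  have tail: "cmod (infsum ?g (- F)) \<le> P - (\<Sum>j\<in>F. cmod (f j))"
    using norm_infsum_bound[OF sg, of "- F"] split(2) unfolding g by simp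
  have "cmod (infsum ?g UNIV) \<le> P"
    using norm_infsum_bound[OF sg, of UNIV] unfolding g P_def .
  moreover have "cmod (sum ?g F) \<le> P"
  proof -
    have "cmod (sum ?g F) \<le> (\<Sum>j\<in>F. cmod (f j))"
      by (rule sum_norm_le) (simp only: g)
    also have "\<dots> \<le> P"
      unfolding P_def by (rule finite_sum_le_infsum[OF f F]) auto
    finally show ?thesis .
  qed
  moreover have "\<bar>cmod (infsum ?g UNIV) - cmod (sum ?g F)\<bar> \<le> P - (\<Sum>j\<in>F. cmod (f j))"
    using tail norm_triangle_ineq3[of "infsum ?g UNIV" "sum ?g F"] split(1) by simp
  ultimately have "\<bar>cmod (infsum ?g UNIV) - cmod (sum ?g F)\<bar> * (cmod (infsum ?g UNIV) + cmod (sum ?g F))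
      \<le> (P - (\<Sum>j\<in>F. cmod (f j))) * (2 * P)"
    by (intro mult_mono) (auto intro: order_trans[OF abs_ge_zero])
  moreover have "\<bar>a\<^sup>2 - b\<^sup>2\<bar> = \<bar>a - b\<bar> * (a + b)" if "a \<ge> 0" "b \<ge> 0" for a b :: real
    using that by (simp add: power2_eq_square square_diff_square_factored abs_mult)
  ultimately show ?thesis by (simp add: gen_fun_def mult_ac)
qed

text \<open>Truncating to a finite set makes the average over
  a fine enough grid of roots of unity exact, so no integral is needed.\<close>

lemma plancherel_comparison:
  fixes p q r :: "int ^ 'd \<Rightarrow> complex"
  assumes p: "(\<lambda>j. cmod (p j)) summable_on UNIV" and q: "(\<lambda>j. cmod (q j)) summable_on UNIV" and r: "(\<lambda>j. cmod (r j)) summable_on UNIV"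
    and nonneg: "0 \<le> \<alpha>" "0 \<le> \<beta>"
    and le: "\<And>\<theta> :: 'd \<Rightarrow> real. (cmod (gen_fun p (\<lambda>k. \<i> * of_real (\<theta> k))))\<^sup>2
        \<le> \<alpha> * (cmod (gen_fun q (\<lambda>k. \<i> * of_real (\<theta> k))))\<^sup>2 + \<beta> * (cmod (gen_fun r (\<lambda>k. \<i> * of_real (\<theta> k))))\<^sup>2"
  shows "(\<Sum>\<^sub>\<infinity>j. (cmod (p j))\<^sup>2) \<le> \<alpha> * (\<Sum>\<^sub>\<infinity>j. (cmod (q j))\<^sup>2) + \<beta> * (\<Sum>\<^sub>\<infinity>j. (cmod (r j))\<^sup>2)"
proof -
  define err where "err f F = 2 * (\<Sum>\<^sub>\<infinity>j. cmod (f j)) * ((\<Sum>\<^sub>\<infinity>j. cmod (f j)) - (\<Sum>j\<in>F. cmod (f j)))"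
    for f :: "int ^ 'd \<Rightarrow> complex" and F
  define sq where "sq f F = (\<Sum>j\<in>F. (cmod (f j))\<^sup>2)" for f :: "int ^ 'd \<Rightarrow> complex" and F
  let ?T = "finite_subsets_at_top (UNIV :: (int ^ 'd) set)"
  have err: "(err f \<longlongrightarrow> 0) ?T" if "(\<lambda>j. cmod (f j)) summable_on UNIV" for f
  proof -
    let ?P = "\<Sum>\<^sub>\<infinity>j. cmod (f j)"
    have "((\<lambda>F. 2 * ?P * (?P - (\<Sum>j\<in>F. cmod (f j)))) \<longlongrightarrow> 2 * ?P * (?P - ?P)) ?T"
      by (intro tendsto_intros infsum_tendsto that)
    then show ?thesis by (simp add: err_def[abs_def])
  qed
  have sq: "(sq f \<longlongrightarrow> (\<Sum>\<^sub>\<infinity>j. (cmod (f j))\<^sup>2)) ?T" if "(\<lambda>j. cmod (f j)) summable_on UNIV" for f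
    unfolding sq_def[abs_def] by (intro infsum_tendsto summable_on_squares that)
  \<comment> \<open>The inequality is passed to truncations at each grid point and summed. The
    errors do not depend on the grid point, so the number of grid points cancels.\<close>
  have fin: "sq p F \<le> \<alpha> * (sq q F + err q F) + \<beta> * (sq r F + err r F) + err p F"
    if F: "finite F" for F
  proof -
    have "finite ((\<lambda>(j, l, k). nat \<bar>j $ k - l $ k\<bar>) ` (F \<times> F \<times> UNIV))" (is "finite ?D")
      using F by auto
    then obtain m where m: "?D \<subseteq> {..<m}" using finite_nat_bounded by blast
    define n where "n = Suc m"
    have n: "n > 0" by (simp add: n_def)
    have dist: "\<bar>j $ k - l $ k\<bar> < int n" if "j \<in> F" "l \<in> F" for j l k
    proof -
      have "nat \<bar>j $ k - l $ k\<bar> \<in> ?D" using that by force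
      then have "nat \<bar>j $ k - l $ k\<bar> < m" using m by blast
      then show ?thesis by (simp add: n_def)
    qed
    let ?G = "torus_grid n :: ('d \<Rightarrow> nat) set"
    define h where "h f x = (cmod (\<Sum>j\<in>F. lat_exp (\<lambda>k. \<i> * of_real (grid_angle n x k)) j * f j))\<^sup>2"
      for f x
    have h: "(\<Sum>x\<in>?G. h f x) = real n ^ CARD('d) * sq f F" for f
      unfolding h_def sq_def by (rule finite_parseval[OF F n dist])
    have card: "real (card ?G) = real n ^ CARD('d)"
      by (simp add: torus_grid_def card_PiE)
    have "h p x \<le> \<alpha> * (h q x + err q F) + \<beta> * (h r x + err r F) + err p F" for x
    proof -
      let ?g = "\<lambda>f. (cmod (gen_fun f (\<lambda>k. \<i> * of_real (grid_angle n x k))))\<^sup>2"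
      have t: "\<bar>?g f - h f x\<bar> \<le> err f F" if "(\<lambda>j. cmod (f j)) summable_on UNIV" for f
        using gen_fun_truncation[OF that F] by (simp add: h_def err_def)
      have "h p x \<le> ?g p + err p F" using t[OF p] by simp
      also have "?g p \<le> \<alpha> * ?g q + \<beta> * ?g r" by (rule le)
      also have "\<dots> \<le> \<alpha> * (h q x + err q F) + \<beta> * (h r x + err r F)"
        using t[OF q] t[OF r] by (intro add_mono mult_left_mono nonneg) auto
      finally show ?thesis by simp
    qed
    then have "(\<Sum>x\<in>?G. h p x) \<le> (\<Sum>x\<in>?G. \<alpha> * (h q x + err q F) + \<beta> * (h r x + err r F) + err p F)"
      by (rule sum_mono)
    also have "\<dots> = \<alpha> * ((\<Sum>x\<in>?G. h q x) + real (card ?G) * err q F)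
        + \<beta> * ((\<Sum>x\<in>?G. h r x) + real (card ?G) * err r F) + real (card ?G) * err p F"
      by (simp add: sum.distrib sum_distrib_left[symmetric])
    also have "\<dots> = real n ^ CARD('d) * (\<alpha> * (sq q F + err q F) + \<beta> * (sq r F + err r F) + err p F)"
      unfolding h card by (simp add: algebra_simps)
    finally show ?thesis
      using n by (simp add: h)
  qed
  \<comment> \<open>Along growing finite sets the truncation errors vanish.\<close>
  have "((\<lambda>F. \<alpha> * (sq q F + err q F) + \<beta> * (sq r F + err r F) + err p F) \<longlongrightarrow>
      \<alpha> * ((\<Sum>\<^sub>\<infinity>j. (cmod (q j))\<^sup>2) + 0) + \<beta> * ((\<Sum>\<^sub>\<infinity>j. (cmod (r j))\<^sup>2) + 0) + 0) ?T"
    by (intro tendsto_intros sq err p q r)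
  from tendsto_le[OF _ this sq[OF p]] show ?thesis
    using fin by (auto intro: eventually_finite_subsets_at_top_weakI)
qed

section \<open>Generating functions of solutions\<close>

lemma exp_sums_times:
  fixes x S :: complex
  shows "(\<lambda>n. x ^ n / fact n * S) sums (exp x * S)"
  using sums_mult2[OF exp_converges[of x], of S]
  by (simp add: scaleR_conv_of_real divide_inverse mult_ac)

text \<open>The double series over Taylor orders and lattice sites converges absolutely. Summed over
  sites first it gives the exponential of the symbol; summed over orders first it gives
  \<open>u t j\<close> at each site.\<close>

lemma solution_gen_fun:
  fixes u :: "real \<Rightarrow> int ^ 'd \<Rightarrow> complex"
  assumes sol: "free_schroedinger_solution u" and t: "t \<in> {0..1}"
    and u0: "(\<lambda>j. cmod (lat_exp z j * u 0 j)) summable_on UNIV"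
  shows "(\<lambda>j. cmod (lat_exp z j * u t j)) summable_on UNIV"
    and "gen_fun (u t) z = exp (\<i> * of_real t * lap_symbol z) * gen_fun (u 0) z"
proof -
  define c where "c n = (\<i> * of_real t) ^ n / (fact n :: complex)" for n
  define w where "w n j = lat_exp z j * (discrete_laplacian ^^ n) (u 0) j" for n j
  define H where "H = (\<lambda>(n, j). c n * w n j)"
  define A where "A = (\<Sum>\<^sub>\<infinity>j. cmod (lat_exp z j * u 0 j))"
  define g where "g n = cmod (c n) * (\<Sum>\<^sub>\<infinity>j. cmod (w n j))" for n
  define S where "S = gen_fun (u 0) z"
  have w: "(\<lambda>j. cmod (w n j)) summable_on UNIV" "(\<Sum>\<^sub>\<infinity>j. cmod (w n j)) \<le> lap_bound z ^ n * A" for n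
    using abs_summable_laplacian_power[OF u0, of n] by (auto simp: w_def A_def)
  have norm_c: "cmod (c n) = t ^ n / fact n" for n
    using t by (simp add: c_def norm_divide norm_mult norm_power)
  \<comment> \<open>For fixed \<open>n\<close> the sum over sites is at most
    \<open>(t * lap_bound z) ^ n / fact n * A\<close>, a term of an exponential series.\<close>
  have "(\<lambda>n. cmod (H n)) summable_on UNIV \<times> UNIV"
  proof (rule summable_on_SigmaI[where g = g])
    show "((\<lambda>j. cmod (H (n, j))) has_sum g n) UNIV" for n
      using has_sum_cmult_right[OF has_sum_infsum[OF w(1)]] by (simp add: H_def g_def norm_mult)
    have "summable (\<lambda>n. inverse (fact n) * (t * lap_bound z) ^ n * A)"
      by (intro summable_mult2 summable_exp)
    moreover have "norm (g n) \<le> inverse (fact n) * (t * lap_bound z) ^ n * A" for n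
    proof -
      have "0 \<le> (\<Sum>\<^sub>\<infinity>j. cmod (w n j))" by (rule infsum_nonneg) simp
      then have "norm (g n) = cmod (c n) * (\<Sum>\<^sub>\<infinity>j. cmod (w n j))" by (simp add: g_def)
      also have "\<dots> \<le> cmod (c n) * (lap_bound z ^ n * A)" by (intro mult_left_mono w) simp
      finally show ?thesis by (simp add: norm_c power_mult_distrib divide_inverse mult_ac)
    qed
    ultimately show "g summable_on UNIV"
      by (intro norm_summable_imp_summable_on) (rule summable_comparison_test'[where N = 0]; simp)
  qed simp
  then have Habs: "(\<lambda>n. norm (H n)) summable_on UNIV \<times> UNIV" .
  then obtain X where X: "(H has_sum X) (UNIV \<times> UNIV)"
    using abs_summable_summable[OF Habs] by (auto simp: summable_on_def)
  have "((\<lambda>j. lat_exp z j * u 0 j) has_sum S) UNIV"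
    unfolding S_def gen_fun_def by (rule has_sum_infsum[OF abs_summable_summable[OF u0]])
  from has_sum_cmult_right[OF has_sum_laplacian_power[OF this]]
  have "((\<lambda>n. c n * (lap_symbol z ^ n * S)) has_sum X) UNIV"
    by (intro has_sum_SigmaD[OF X]) (simp add: H_def w_def)
  then have "(\<lambda>n. c n * (lap_symbol z ^ n * S)) sums X"
    by (rule has_sum_imp_sums)
  moreover have "(\<lambda>n. c n * (lap_symbol z ^ n * S)) sums (exp (\<i> * of_real t * lap_symbol z) * S)"
    using exp_sums_times[of "\<i> * of_real t * lap_symbol z" S]
    by (simp add: c_def power_mult_distrib mult_ac)
  ultimately have X_eq: "X = exp (\<i> * of_real t * lap_symbol z) * S"
    by (rule sums_unique2)
  \<comment> \<open>From here on the order of summation is reversed, with the orders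
    \<open>n\<close> inside.\<close>
  have Habs': "(\<lambda>(j, n). norm (H (n, j))) summable_on UNIV \<times> UNIV"
    using Habs by (subst (asm) summable_on_swap)
  then have Habs'': "(\<lambda>p. norm (case p of (j, n) \<Rightarrow> H (n, j))) summable_on UNIV \<times> UNIV"
    by (simp add: case_prod_unfold)
  note sum_iter = Infinite_Sum.abs_summable_on_Sigma_iff[THEN iffD1, OF Habs'']
  have sn: "(\<lambda>n. norm (H (n, j))) summable_on UNIV" for j
    using sum_iter by simp
  have sj: "(\<lambda>j. \<Sum>\<^sub>\<infinity>n. norm (H (n, j))) summable_on UNIV"
    using conjunct2[OF sum_iter] by (simp only: summable_on_iff_abs_summable_on_real[symmetric] prod.case)
  have ut: "((\<lambda>n. H (n, j)) has_sum (lat_exp z j * u t j)) UNIV" for j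
  proof -
    have "(\<lambda>n. H (n, j)) sums (lat_exp z j * u t j)"
      using sums_mult[OF solution_taylor_sums[OF sol t, of j], of "lat_exp z j"]
      by (simp add: H_def c_def w_def mult_ac)
    moreover have "(\<lambda>n. H (n, j)) summable_on UNIV"
      by (rule abs_summable_summable[OF sn])
    ultimately show ?thesis
      using has_sum_imp_sums has_sum_infsum sums_unique2 by metis
  qed
  have "((\<lambda>(j, n). H (n, j)) has_sum X) (UNIV \<times> UNIV)"
    using X by (subst (asm) has_sum_swap)
  then have "((\<lambda>j. lat_exp z j * u t j) has_sum X) UNIV"
    by (rule has_sum_SigmaD) (simp add: ut)
  then show "gen_fun (u t) z = exp (\<i> * of_real t * lap_symbol z) * gen_fun (u 0) z"
    unfolding gen_fun_def X_eq S_def by (rule infsumI)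
  have "cmod (lat_exp z j * u t j) \<le> (\<Sum>\<^sub>\<infinity>n. norm (H (n, j)))" for j
    using norm_infsum_bound[OF sn] infsumI[OF ut] by metis
  then show "(\<lambda>j. cmod (lat_exp z j * u t j)) summable_on UNIV"
    by (intro summable_on_comparison_test[OF sj]) auto
qed

section \<open>Gaussian decay gives absolute convergence for every exponential weight\<close>

lemma summable_on_lattice_prod:
  fixes h :: "'d::finite \<Rightarrow> int \<Rightarrow> real"
  assumes h: "\<And>k. h k summable_on UNIV" and nonneg: "\<And>k m. 0 \<le> h k m"
  shows "(\<lambda>j :: int ^ 'd. \<Prod>k\<in>UNIV. h k (j $ k)) summable_on UNIV"
proof (rule nonneg_bdd_above_summable_on)
  show "bdd_above (sum (\<lambda>j :: int ^ 'd. \<Prod>k\<in>UNIV. h k (j $ k)) ` {F. F \<subseteq> UNIV \<and> finite F})"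
  proof (rule bdd_aboveI2)
    fix F :: "(int ^ 'd) set" assume "F \<in> {F. F \<subseteq> UNIV \<and> finite F}"
    then have F: "finite F" by simp
    \<comment> \<open>\<open>F\<close> lies in the box of its coordinate projections, and over a box
      the sum of products is a product of sums.\<close>
    define B where "B k = (\<lambda>j. j $ k) ` F" for k
    have B: "finite (B k)" for k using F by (simp add: B_def)
    have inj: "inj_on (\<lambda>j k. j $ k) F" by (auto simp: inj_on_def vec_eq_iff fun_eq_iff)
    have "(\<Sum>j\<in>F. \<Prod>k\<in>UNIV. h k (j $ k)) = (\<Sum>x\<in>(\<lambda>j k. j $ k) ` F. \<Prod>k\<in>UNIV. h k (x k))"
      by (simp add: sum.reindex[OF inj])
    also have "\<dots> \<le> (\<Sum>x\<in>PiE UNIV B. \<Prod>k\<in>UNIV. h k (x k))"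
    proof (rule sum_mono2)
      show "finite (PiE UNIV B)" by (intro finite_PiE) (simp_all add: B)
      show "(\<lambda>j k. j $ k) ` F \<subseteq> PiE UNIV B" by (auto simp: B_def)
    qed (simp add: prod_nonneg nonneg)
    also have "\<dots> = (\<Prod>k\<in>UNIV. \<Sum>m\<in>B k. h k m)"
      by (rule prod_sum_PiE[symmetric]) (auto simp: B)
    also have "\<dots> \<le> (\<Prod>k\<in>UNIV. \<Sum>\<^sub>\<infinity>m. h k m)"
      by (intro prod_mono conjI sum_nonneg finite_sum_le_infsum[OF h B]) (auto simp: nonneg)
    finally show "(\<Sum>j\<in>F. \<Prod>k\<in>UNIV. h k (j $ k)) \<le> (\<Prod>k\<in>UNIV. \<Sum>\<^sub>\<infinity>m. h k m)" .
  qed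
qed (simp add: prod_nonneg nonneg)

lemma summable_on_exp_minus_abs: "(\<lambda>m::int. exp (- \<bar>of_int m\<bar>) :: real) summable_on UNIV"
proof -
  let ?e = "\<lambda>m::int. exp (- \<bar>of_int m\<bar>) :: real"
  have "summable (\<lambda>n. exp (-1::real) ^ n)" by (rule summable_geometric) simp
  then have n: "(\<lambda>n. exp (- real n)) summable_on UNIV"
    by (intro norm_summable_imp_summable_on) (simp add: exp_of_nat_mult[symmetric])
  have "?e summable_on range int" "?e summable_on range (\<lambda>n. - int n)"
    using n by (auto simp: summable_on_reindex inj_on_def o_def)
  then have "?e summable_on range int \<union> range (\<lambda>n. - int n)" by (rule summable_on_union)
  moreover have "range int \<union> range (\<lambda>n. - int n) = UNIV"
  proof -
    have "m \<in> range int \<union> range (\<lambda>n. - int n)" for m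
      by (cases m rule: int_cases2) auto
    then show ?thesis by blast
  qed
  ultimately show ?thesis by simp
qed

lemma summable_on_int_gaussian:
  fixes y lam :: real
  assumes "lam > 0"
  shows "(\<lambda>m::int. exp (y * of_int m - lam * (of_int m)\<^sup>2)) summable_on UNIV"
proof (rule summable_on_comparison_test)
  \<comment> \<open>\<open>K\<close> comes from completing the square in
    \<open>lam * m^2 - (\<bar>y\<bar> + 1) * \<bar>m\<bar>\<close>; the extra 1 leaves
    \<open>exp (- \<bar>m\<bar>)\<close> to be summed.\<close>
  define K where "K = (\<bar>y\<bar> + 1)\<^sup>2 / (4 * lam)"
  show "(\<lambda>m::int. exp K * exp (- \<bar>of_int m\<bar>)) summable_on UNIV"
    by (intro summable_on_cmult_right summable_on_exp_minus_abs)
  fix m :: int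
  have "0 \<le> (2 * lam * \<bar>real_of_int m\<bar> - (\<bar>y\<bar> + 1))\<^sup>2 / (4 * lam)" using assms by simp
  also have "\<dots> = lam * (of_int m)\<^sup>2 - (\<bar>y\<bar> + 1) * \<bar>real_of_int m\<bar> + K"
    using assms by (simp add: K_def field_simps power2_eq_square)
  finally have "\<bar>y\<bar> * \<bar>real_of_int m\<bar> - lam * (of_int m)\<^sup>2 \<le> K - \<bar>real_of_int m\<bar>"
    by (simp add: algebra_simps)
  moreover have "y * of_int m \<le> \<bar>y\<bar> * \<bar>real_of_int m\<bar>"
    by (metis abs_ge_self abs_mult)
  ultimately show "exp (y * of_int m - lam * (of_int m)\<^sup>2) \<le> exp K * exp (- \<bar>of_int m\<bar>)"
    by (simp add: exp_add[symmetric])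
qed simp

lemma lattice_norm_squared: "(lattice_norm j)\<^sup>2 = (\<Sum>k\<in>UNIV. (of_int (j $ k))\<^sup>2)"
  by (simp add: lattice_norm_def norm_vec_def L2_set_def sum_nonneg)

text \<open>The term is split as \<open>a * b\<close>, with the Gaussian weight in \<open>a\<close>
  and its reciprocal in \<open>b\<close>. Then \<open>a * b \<le> a^2 + b^2\<close>, where
  \<open>b^2\<close> is a product of one-dimensional Gaussians.\<close>

lemma gauss_density_imp_exp_decay:
  fixes f :: "int ^ 'd \<Rightarrow> complex"
  assumes lam: "lam > 0" and f: "gauss_density lam f summable_on UNIV"
  shows "(\<lambda>j. cmod (lat_exp z j * f j)) summable_on UNIV"
proof (rule summable_on_comparison_test)
  define h where "h k m = exp (2 * Re (z k) * of_int m - 2 * lam * (of_int m)\<^sup>2)" for k and m :: int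
  have "(\<lambda>j :: int ^ 'd. \<Prod>k\<in>UNIV. h k (j $ k)) summable_on UNIV"
    using lam by (intro summable_on_lattice_prod)
      (auto simp: h_def intro!: summable_on_int_gaussian[of "2 * lam" "2 * Re (z _)", simplified])
  then show "(\<lambda>j. gauss_density lam f j + (\<Prod>k\<in>UNIV. h k (j $ k))) summable_on UNIV"
    by (rule summable_on_add[OF f])
  fix j
  define a where "a = exp (lam * (lattice_norm j)\<^sup>2) * cmod (f j)"
  define b where "b = exp ((\<Sum>k\<in>UNIV. Re (z k) * of_int (j $ k)) - lam * (lattice_norm j)\<^sup>2)"
  have "cmod (lat_exp z j * f j) = a * b"
    by (simp add: norm_mult norm_lat_exp a_def b_def exp_diff)
  also have "\<dots> \<le> a\<^sup>2 + b\<^sup>2"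
  proof -
    have "0 \<le> a * b" by (simp add: a_def b_def)
    then show ?thesis using sum_squares_bound[of a b] by linarith
  qed
  also have "a\<^sup>2 = gauss_density lam f j"
    by (simp add: a_def gauss_density_def power_mult_distrib exp_double[symmetric] mult_ac)
  also have "b\<^sup>2 = (\<Prod>k\<in>UNIV. h k (j $ k))"
    by (simp add: b_def h_def lattice_norm_squared exp_double[symmetric] exp_sum[symmetric]
        sum_distrib_left sum_subtractf right_diff_distrib mult_ac)
  finally show "cmod (lat_exp z j * f j) \<le> gauss_density lam f j + (\<Prod>k\<in>UNIV. h k (j $ k))" .
qed simp

section \<open>From exponential to Gaussian weights\<close>

lemma sinh_le_mult_cosh:
  fixes x :: real
  assumes "0 \<le> x"
  shows "sinh x \<le> x * cosh x"
proof -
  have "0 * cosh 0 - sinh 0 \<le> x * cosh x - sinh x"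
  proof (rule DERIV_nonneg_imp_nondecreasing[OF assms])
    fix y :: real assume "0 \<le> y" "y \<le> x"
    then show "\<exists>D. ((\<lambda>x. x * cosh x - sinh x) has_real_derivative D) (at y) \<and> 0 \<le> D"
      by (intro exI[of _ "y * sinh y"]) (auto intro!: derivative_eq_intros)
  qed
  then show ?thesis by simp
qed

text \<open>By \<open>sinh t \<le> t * cosh t\<close> the quotient of the two sides decreases for
  \<open>t \<ge> 0\<close>, and both sides are even. This puts the hyperbolic approximations below
  the Gaussian weight.\<close>

lemma cosh_le_exp_half_square: "cosh x \<le> exp (x\<^sup>2 / 2)" for x :: real
proof -
  define y where "y = \<bar>x\<bar>"
  have "cosh y * exp (- y\<^sup>2 / 2) \<le> cosh 0 * exp (- 0\<^sup>2 / 2)"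
  proof (rule DERIV_nonpos_imp_nonincreasing[of 0 y "\<lambda>t. cosh t * exp (- t\<^sup>2 / 2)"])
    show "0 \<le> y" by (simp add: y_def)
    fix t :: real assume "0 \<le> t" "t \<le> y"
    then show "\<exists>D. ((\<lambda>t. cosh t * exp (- t\<^sup>2 / 2)) has_real_derivative D) (at t) \<and> D \<le> 0"
      using sinh_le_mult_cosh[of t]
      by (intro exI[of _ "(sinh t - t * cosh t) * exp (- t\<^sup>2 / 2)"])
         (auto intro!: derivative_eq_intros mult_nonpos_nonneg simp: algebra_simps)
  qed
  then have "cosh y * exp (- y\<^sup>2 / 2) * exp (y\<^sup>2 / 2) \<le> 1 * exp (y\<^sup>2 / 2)"
    by (intro mult_right_mono) auto
  then show ?thesis by (simp add: y_def mult.assoc exp_add[symmetric] abs_if split: if_splits)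
qed

text \<open>To leading order \<open>cosh (c / sqrt n)\<close> is \<open>1 + c^2 / (2 * n)\<close>.
  The asymptotic computation takes a positive constant; evenness and the case 0 cover the
  rest.\<close>

lemma cosh_power_tendsto_gaussian:
  "(\<lambda>n. cosh (c / sqrt (real n)) ^ n) \<longlonglongrightarrow> exp (c\<^sup>2 / 2)"
proof -
  have "(\<lambda>n. cosh (d / sqrt (real n)) ^ n) \<longlonglongrightarrow> exp (d * d / 2)" if "d > 0" for d :: real
    using that by real_asymp
  from this[of "\<bar>c\<bar>"] have "(\<lambda>n. cosh (\<bar>c\<bar> / sqrt (real n)) ^ n) \<longlonglongrightarrow> exp (c\<^sup>2 / 2)"
    by (cases "c = 0") (auto simp: power2_eq_square)
  moreover have "cosh (\<bar>c\<bar> / sqrt (real n)) = cosh (c / sqrt (real n))" for n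
    by (simp add: abs_if)
  ultimately show ?thesis by simp
qed

section \<open>Time inequalities for exponential weights\<close>

definition exp_density :: "('d::finite \<Rightarrow> real) \<Rightarrow> (int ^ 'd \<Rightarrow> complex) \<Rightarrow> int ^ 'd \<Rightarrow> real" where
  "exp_density y f j = exp (\<Sum>k\<in>UNIV. y k * of_int (j $ k)) * (cmod (f j))\<^sup>2"

text \<open>Halving the exponent moves the weight inside the square, so the Plancherel comparison
  applies to weighted sums.\<close>

lemma exp_density_eq:
  "exp_density y f j = (cmod (lat_exp (\<lambda>k. of_real (y k / 2)) j * f j))\<^sup>2"
proof -
  have "2 * (\<Sum>k\<in>UNIV. y k / 2 * of_int (j $ k)) = (\<Sum>k\<in>UNIV. y k * of_int (j $ k))"
    unfolding sum_distrib_left by (intro sum.cong) auto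
  then have "exp (\<Sum>k\<in>UNIV. y k * of_int (j $ k)) = exp (\<Sum>k\<in>UNIV. y k / 2 * of_int (j $ k)) ^ 2"
    by (simp only: exp_double[symmetric])
  then show ?thesis
    by (simp add: exp_density_def norm_mult norm_lat_exp power_mult_distrib)
qed

lemma exp_density_cosh:
  fixes j :: "int ^ 'd"
  shows "cosh (a * of_int (j $ k)) * exp_density y f j
     = (exp_density (y(k := y k + a)) f j + exp_density (y(k := y k - a)) f j) / 2"
proof -
  have "(\<Sum>l\<in>UNIV. (y(k := y k + b)) l * of_int (j $ l)) = (\<Sum>l\<in>UNIV. y l * of_int (j $ l)) + b * real_of_int (j $ k)" for b
  proof -
    have "(\<Sum>l\<in>UNIV. (y(k := y k + b)) l * of_int (j $ l))
        = (\<Sum>l\<in>UNIV. y l * of_int (j $ l) + (if l = k then b * real_of_int (j $ k) else 0))"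
      by (intro sum.cong) (auto simp: algebra_simps)
    then show ?thesis by (simp add: sum.distrib)
  qed
  note shift = this[of a] this[of "- a", folded diff_conv_add_uminus, unfolded mult_minus_left, folded diff_conv_add_uminus]
  show ?thesis
    unfolding exp_density_def shift cosh_field_def exp_add exp_diff exp_minus
    by (simp add: field_simps)
qed

lemma solution_exp_density_summable:
  fixes u :: "real \<Rightarrow> int ^ 'd \<Rightarrow> complex"
  assumes "free_schroedinger_solution u" "t \<in> {0..1}"
    and "\<And>z. (\<lambda>j. cmod (lat_exp z j * u 0 j)) summable_on UNIV"
  shows "exp_density y (u t) summable_on UNIV"
proof -
  have "exp_density y (u t) = (\<lambda>j. (cmod (lat_exp (\<lambda>k. of_real (y k / 2)) j * u t j))\<^sup>2)"
    by (rule ext) (rule exp_density_eq)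
  moreover have "\<dots> summable_on UNIV"
    by (rule summable_on_squares[OF solution_gen_fun(1)[OF assms]])
  ultimately show ?thesis by simp
qed

text \<open>At fixed complex \<open>z\<close> the squared modulus of the generating function is a
  constant times \<open>exp (t * x)\<close>, so \<open>le\<close> applies; Plancherel carries the
  inequality to the weighted sums.\<close>

lemma solution_exp_density_le:
  fixes u :: "real \<Rightarrow> int ^ 'd \<Rightarrow> complex"
  assumes sol: "free_schroedinger_solution u"
    and u0: "\<And>z. (\<lambda>j. cmod (lat_exp z j * u 0 j)) summable_on UNIV"
    and t: "r \<in> {0..1}" "t0 \<in> {0..1}" "t1 \<in> {0..1}"
    and nonneg: "0 \<le> \<alpha>" "0 \<le> \<beta>"
    and le: "\<And>x :: real. exp (r * x) \<le> \<alpha> * exp (t0 * x) + \<beta> * exp (t1 * x)"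
  shows "(\<Sum>\<^sub>\<infinity>j. exp_density y (u r) j)
     \<le> \<alpha> * (\<Sum>\<^sub>\<infinity>j. exp_density y (u t0) j) + \<beta> * (\<Sum>\<^sub>\<infinity>j. exp_density y (u t1) j)"
  unfolding exp_density_eq
proof (rule plancherel_comparison[OF _ _ _ nonneg])
  fix \<theta> :: "'d \<Rightarrow> real"
  define z where "z k = of_real (y k / 2) + \<i> * of_real (\<theta> k)" for k
  \<comment> \<open>The squared modulus of \<open>exp (\<i> * t * m)\<close> is
    \<open>exp (- 2 * t * Im m)\<close>.\<close>
  define x where "x = - 2 * Im (lap_symbol z)"
  have "(cmod (gen_fun (\<lambda>j. lat_exp (\<lambda>k. of_real (y k / 2)) j * u t j) (\<lambda>k. \<i> * of_real (\<theta> k))))\<^sup>2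
      = exp (t * x) * (cmod (gen_fun (u 0) z))\<^sup>2" if t: "t \<in> {0..1}" for t
  proof -
    have "gen_fun (\<lambda>j. lat_exp (\<lambda>k. of_real (y k / 2)) j * u t j) (\<lambda>k. \<i> * of_real (\<theta> k))
        = gen_fun (u t) z"
      unfolding gen_fun_def z_def lat_exp_plus by (simp add: mult_ac)
    also have "\<dots> = exp (\<i> * of_real t * lap_symbol z) * gen_fun (u 0) z"
      by (rule solution_gen_fun(2)[OF sol t u0])
    finally show ?thesis
      by (simp add: norm_mult power_mult_distrib exp_double[symmetric] x_def mult_ac)
  qed
  note eq = this
  show "(cmod (gen_fun (\<lambda>j. lat_exp (\<lambda>k. of_real (y k / 2)) j * u r j) (\<lambda>k. \<i> * of_real (\<theta> k))))\<^sup>2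
      \<le> \<alpha> * (cmod (gen_fun (\<lambda>j. lat_exp (\<lambda>k. of_real (y k / 2)) j * u t0 j) (\<lambda>k. \<i> * of_real (\<theta> k))))\<^sup>2
        + \<beta> * (cmod (gen_fun (\<lambda>j. lat_exp (\<lambda>k. of_real (y k / 2)) j * u t1 j) (\<lambda>k. \<i> * of_real (\<theta> k))))\<^sup>2"
    unfolding eq[OF t(1)] eq[OF t(2)] eq[OF t(3)]
    using mult_right_mono[OF le[of x], of "(cmod (gen_fun (u 0) z))\<^sup>2"]
    by (simp add: algebra_simps)
qed (rule solution_gen_fun(1)[OF sol _ u0], rule t)+

text \<open>Multiplying a weight by \<open>cosh (a j\<^sub>k)\<close> averages two shifts of the exponent \<open>y\<close>, so the induction
  has to carry all \<open>y\<close> along.\<close>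

lemma cosh_weight_comparison:
  fixes f g h :: "int ^ 'd \<Rightarrow> complex" and a :: real and n :: nat
  assumes summable: "\<And>y. exp_density y f summable_on UNIV" "\<And>y. exp_density y g summable_on UNIV"
      "\<And>y. exp_density y h summable_on UNIV"
    and le: "\<And>y. (\<Sum>\<^sub>\<infinity>j. exp_density y f j)
      \<le> \<alpha> * (\<Sum>\<^sub>\<infinity>j. exp_density y g j) + \<beta> * (\<Sum>\<^sub>\<infinity>j. exp_density y h j)"
  defines "W \<equiv> \<lambda>j. \<Prod>k\<in>UNIV. cosh (a * of_int (j $ k)) ^ n"
  shows "(\<lambda>j. W j * (cmod (f j))\<^sup>2) summable_on UNIV"
    and "(\<Sum>\<^sub>\<infinity>j. W j * (cmod (f j))\<^sup>2)
      \<le> \<alpha> * (\<Sum>\<^sub>\<infinity>j. W j * (cmod (g j))\<^sup>2) + \<beta> * (\<Sum>\<^sub>\<infinity>j. W j * (cmod (h j))\<^sup>2)"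
proof -
  define P where "P w \<longleftrightarrow> (\<forall>y. (\<forall>v\<in>{f, g, h}. (\<lambda>j. w j * exp_density y v j) summable_on UNIV) \<and>
      (\<Sum>\<^sub>\<infinity>j. w j * exp_density y f j)
        \<le> \<alpha> * (\<Sum>\<^sub>\<infinity>j. w j * exp_density y g j) + \<beta> * (\<Sum>\<^sub>\<infinity>j. w j * exp_density y h j))"
    for w :: "int ^ 'd \<Rightarrow> real"
  have cosh_step: "P (\<lambda>j. cosh (a * of_int (j $ k)) * w j)" if w: "P w" for w k
    unfolding P_def
  proof (intro allI conjI ballI)
    fix y
    define y1 y2 where "y1 = y(k := y k + a)" and "y2 = y(k := y k - a)"
    have eq: "cosh (a * of_int (j $ k)) * w j * exp_density y v j
        = (1/2) * (w j * exp_density y1 v j + w j * exp_density y2 v j)" for v j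
    proof -
      have "cosh (a * of_int (j $ k)) * w j * exp_density y v j
          = w j * (cosh (a * of_int (j $ k)) * exp_density y v j)" by simp
      then show ?thesis unfolding exp_density_cosh y1_def y2_def by (simp add: algebra_simps)
    qed
    have s: "(\<lambda>j. w j * exp_density y v j) summable_on UNIV" if "v \<in> {f, g, h}" for y v
      using w that unfolding P_def by blast
    show "(\<lambda>j. cosh (a * of_int (j $ k)) * w j * exp_density y v j) summable_on UNIV"
      if "v \<in> {f, g, h}" for v
      unfolding eq by (intro summable_on_cmult_right summable_on_add s that)
    have i: "(\<Sum>\<^sub>\<infinity>j. cosh (a * of_int (j $ k)) * w j * exp_density y v j)
        = (1/2) * ((\<Sum>\<^sub>\<infinity>j. w j * exp_density y1 v j) + (\<Sum>\<^sub>\<infinity>j. w j * exp_density y2 v j))"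
      if "v \<in> {f, g, h}" for v
      unfolding eq by (simp only: infsum_cmult_right' infsum_add[OF s[OF that] s[OF that]])
    have "(\<Sum>\<^sub>\<infinity>j. w j * exp_density y f j)
        \<le> \<alpha> * (\<Sum>\<^sub>\<infinity>j. w j * exp_density y g j) + \<beta> * (\<Sum>\<^sub>\<infinity>j. w j * exp_density y h j)" for y
      using w unfolding P_def by blast
    then have "(1/2) * ((\<Sum>\<^sub>\<infinity>j. w j * exp_density y1 f j) + (\<Sum>\<^sub>\<infinity>j. w j * exp_density y2 f j))
      \<le> (1/2) * ((\<alpha> * (\<Sum>\<^sub>\<infinity>j. w j * exp_density y1 g j) + \<beta> * (\<Sum>\<^sub>\<infinity>j. w j * exp_density y1 h j))
        + (\<alpha> * (\<Sum>\<^sub>\<infinity>j. w j * exp_density y2 g j) + \<beta> * (\<Sum>\<^sub>\<infinity>j. w j * exp_density y2 h j)))"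
      by (intro mult_left_mono add_mono) auto
    also have "\<dots> = \<alpha> * (\<Sum>\<^sub>\<infinity>j. cosh (a * of_int (j $ k)) * w j * exp_density y g j)
        + \<beta> * (\<Sum>\<^sub>\<infinity>j. cosh (a * of_int (j $ k)) * w j * exp_density y h j)"
      unfolding i[OF insertI2[OF insertI1]] i[OF insertI2[OF insertI2[OF insertI1]]]
      by (simp only: distrib_left mult_ac add_ac)
    finally show "(\<Sum>\<^sub>\<infinity>j. cosh (a * of_int (j $ k)) * w j * exp_density y f j)
      \<le> \<alpha> * (\<Sum>\<^sub>\<infinity>j. cosh (a * of_int (j $ k)) * w j * exp_density y g j)
        + \<beta> * (\<Sum>\<^sub>\<infinity>j. cosh (a * of_int (j $ k)) * w j * exp_density y h j)"
      unfolding i[OF insertI1] .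
  qed
  \<comment> \<open>The factors enter one at a time: \<open>n\<close> of them for one coordinate,
    then coordinate by coordinate.\<close>
  have power_step: "P (\<lambda>j. cosh (a * of_int (j $ k)) ^ n * w j)" if w: "P w" for w k n
  proof (induction n)
    case (Suc n)
    from cosh_step[OF this, of k] show ?case by (simp add: mult.assoc)
  qed (use w in simp)
  have "P (\<lambda>j. \<Prod>k\<in>K. cosh (a * of_int (j $ k)) ^ n)" if "finite K" for K
    using that
  proof induction
    case empty
    then show ?case using summable le by (auto simp: P_def)
  next
    case (insert k K)
    then show ?case using power_step[of "\<lambda>j. \<Prod>k\<in>K. cosh (a * of_int (j $ k)) ^ n" k n] by simp
  qed
  then have "P W" unfolding W_def by simp
  have "exp_density (\<lambda>k. 0) v = (\<lambda>j. (cmod (v j))\<^sup>2)" for v :: "int ^ 'd \<Rightarrow> complex"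
    by (simp add: exp_density_def fun_eq_iff)
  moreover have "(\<lambda>j. W j * exp_density (\<lambda>k. 0) f j) summable_on UNIV"
    "(\<Sum>\<^sub>\<infinity>j. W j * exp_density (\<lambda>k. 0) f j)
      \<le> \<alpha> * (\<Sum>\<^sub>\<infinity>j. W j * exp_density (\<lambda>k. 0) g j) + \<beta> * (\<Sum>\<^sub>\<infinity>j. W j * exp_density (\<lambda>k. 0) h j)"
    using \<open>P W\<close> unfolding P_def by blast+
  ultimately show "(\<lambda>j. W j * (cmod (f j))\<^sup>2) summable_on UNIV"
    and "(\<Sum>\<^sub>\<infinity>j. W j * (cmod (f j))\<^sup>2)
      \<le> \<alpha> * (\<Sum>\<^sub>\<infinity>j. W j * (cmod (g j))\<^sup>2) + \<beta> * (\<Sum>\<^sub>\<infinity>j. W j * (cmod (h j))\<^sup>2)"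
    by simp_all
qed

section \<open>Passage to the Gaussian weight\<close>

lemma gauss_density_comparison:
  fixes f g h :: "int ^ 'd \<Rightarrow> complex"
  assumes lam: "lam > 0" and nonneg: "0 \<le> \<alpha>" "0 \<le> \<beta>"
    and summable: "\<And>y. exp_density y f summable_on UNIV" "\<And>y. exp_density y g summable_on UNIV"
      "\<And>y. exp_density y h summable_on UNIV"
    and le: "\<And>y. (\<Sum>\<^sub>\<infinity>j. exp_density y f j)
      \<le> \<alpha> * (\<Sum>\<^sub>\<infinity>j. exp_density y g j) + \<beta> * (\<Sum>\<^sub>\<infinity>j. exp_density y h j)"
    and gauss: "gauss_density lam g summable_on UNIV" "gauss_density lam h summable_on UNIV"
  shows "gauss_density lam f summable_on UNIV"
    and "(\<Sum>\<^sub>\<infinity>j. gauss_density lam f j)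
      \<le> \<alpha> * (\<Sum>\<^sub>\<infinity>j. gauss_density lam g j) + \<beta> * (\<Sum>\<^sub>\<infinity>j. gauss_density lam h j)"
proof -
  let ?R = "\<alpha> * (\<Sum>\<^sub>\<infinity>j. gauss_density lam g j) + \<beta> * (\<Sum>\<^sub>\<infinity>j. gauss_density lam h j)"
  \<comment> \<open>For \<open>x = 2 * sqrt lam * j $ k\<close> the exponent \<open>x^2 / 2\<close>
    is \<open>2 * lam * (j $ k)^2\<close>, so these weights tend to the Gaussian one.\<close>
  define W where "W n j = (\<Prod>k\<in>UNIV. cosh (2 * sqrt lam / sqrt (real n) * of_int (j $ k)) ^ n)"
    for n and j :: "int ^ 'd"
  have gd: "gauss_density lam v j = (\<Prod>k\<in>UNIV. exp ((2 * sqrt lam * of_int (j $ k))\<^sup>2 / 2)) * (cmod (v j))\<^sup>2"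
    for v and j :: "int ^ 'd"
    using lam by (simp add: gauss_density_def lattice_norm_squared exp_sum[symmetric]
        sum_distrib_left power_mult_distrib mult_ac)
  have W_nonneg: "0 \<le> W n j" for n j
    by (simp add: W_def prod_nonneg)
  have W_le: "W n j * (cmod (v j))\<^sup>2 \<le> gauss_density lam v j" if "n > 0" for n v j
    unfolding gd W_def
  proof (intro mult_right_mono prod_mono conjI)
    fix k
    let ?x = "2 * sqrt lam / sqrt (real n) * of_int (j $ k)"
    have "cosh ?x ^ n \<le> exp (?x\<^sup>2 / 2) ^ n"
      by (intro power_mono cosh_le_exp_half_square) simp
    also have "\<dots> = exp ((2 * sqrt lam * of_int (j $ k))\<^sup>2 / 2)"
      using that by (simp add: exp_of_nat_mult[symmetric] power_mult_distrib power_divide)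
    finally show "cosh ?x ^ n \<le> exp ((2 * sqrt lam * of_int (j $ k))\<^sup>2 / 2)" .
  qed auto
  have W_le_infsum: "(\<Sum>\<^sub>\<infinity>j. W n j * (cmod (v j))\<^sup>2) \<le> (\<Sum>\<^sub>\<infinity>j. gauss_density lam v j)"
    if "n > 0" "gauss_density lam v summable_on UNIV" for n v
    using W_le[OF that(1)] W_nonneg that(2)
    by (intro infsum_mono summable_on_comparison_test[OF that(2)]) (auto simp: gauss_density_def)
  \<comment> \<open>The limit in \<open>n\<close> is taken on a finite set, where it commutes with
    the sum. The bound is independent of \<open>F\<close>, so it yields both summability and the
    inequality.\<close>
  have fin: "(\<Sum>j\<in>F. gauss_density lam f j) \<le> ?R" if F: "finite F" for F
  proof (rule tendsto_upperbound)
    show "(\<lambda>n. \<Sum>j\<in>F. W n j * (cmod (f j))\<^sup>2) \<longlonglongrightarrow> (\<Sum>j\<in>F. gauss_density lam f j)"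
      unfolding gd W_def using cosh_power_tendsto_gaussian[of "2 * sqrt lam * _"]
      by (intro tendsto_sum tendsto_mult tendsto_prod tendsto_const) simp
    have "(\<Sum>j\<in>F. W n j * (cmod (f j))\<^sup>2) \<le> ?R" if "n > 0" for n
    proof -
      note c = cosh_weight_comparison[OF summable le,
          where a = "2 * sqrt lam / sqrt (real n)" and n = n, folded W_def]
      have "(\<Sum>j\<in>F. W n j * (cmod (f j))\<^sup>2) \<le> (\<Sum>\<^sub>\<infinity>j. W n j * (cmod (f j))\<^sup>2)"
        by (rule finite_sum_le_infsum[OF c(1) F]) (auto simp: W_nonneg)
      also note c(2)
      also have "\<alpha> * (\<Sum>\<^sub>\<infinity>j. W n j * (cmod (g j))\<^sup>2) + \<beta> * (\<Sum>\<^sub>\<infinity>j. W n j * (cmod (h j))\<^sup>2) \<le> ?R"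
        by (intro add_mono mult_left_mono nonneg W_le_infsum that gauss)
      finally show ?thesis .
    qed
    then show "\<forall>\<^sub>F n in sequentially. (\<Sum>j\<in>F. W n j * (cmod (f j))\<^sup>2) \<le> ?R"
      by (rule eventually_mono[OF eventually_gt_at_top])
  qed simp
  have pos: "0 \<le> gauss_density lam f j" for j by (simp add: gauss_density_def)
  show s: "gauss_density lam f summable_on UNIV"
    by (rule nonneg_bdd_above_summable_on) (use fin pos in \<open>auto intro!: bdd_aboveI2\<close>)
  show "(\<Sum>\<^sub>\<infinity>j. gauss_density lam f j) \<le> ?R"
    by (rule infsum_le_finite_sums[OF s]) (use fin in auto)
qed

section \<open>Logarithmic convexity from the family of linear inequalities\<close>

lemma exp_convex_combination:
  fixes a b s l :: real
  assumes "0 < s" "s < 1"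
  shows "exp ((1 - s) * a + s * b) \<le> (1 - s) * exp (s * l) * exp a + s * exp (- (1 - s) * l) * exp b"
proof -
  \<comment> \<open>Shifting the two points by \<open>s * l\<close> and \<open>- (1 - s) * l\<close>
    leaves their weighted mean unchanged, so \<open>l\<close> is free.\<close>
  have "exp ((1 - s) *\<^sub>R (a + s * l) + s *\<^sub>R (b - (1 - s) * l))
      \<le> (1 - s) * exp (a + s * l) + s * exp (b - (1 - s) * l)"
    using assms by (intro convex_onD[OF exp_convex]) auto
  then show ?thesis by (simp add: algebra_simps exp_add[symmetric])
qed

theorem theorem2p3:
  fixes u :: "real \<Rightarrow> int ^ 'd \<Rightarrow> complex" and lam :: real
  assumes "lam > 0"
    and "free_schroedinger_solution u"
    and "gauss_density lam (u 0) summable_on UNIV"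
    and "gauss_density lam (u 1) summable_on UNIV"
  shows "(\<forall>t\<in>{0..1}. gauss_density lam (u t) summable_on UNIV) \<and>
         log_convex_unit (\<lambda>t. \<Sum>\<^sub>\<infinity>j. gauss_density lam (u t) j)"
proof -
  define G where "G t = (\<Sum>\<^sub>\<infinity>j. gauss_density lam (u t) j)" for t
  have u0: "(\<lambda>j. cmod (lat_exp z j * u 0 j)) summable_on UNIV" for z
    by (rule gauss_density_imp_exp_decay[OF assms(1,3)])
  have key: "gauss_density lam (u ((1 - s) * t0 + s * t1)) summable_on UNIV \<and>
      G ((1 - s) * t0 + s * t1) \<le> (1 - s) * exp (s * l) * G t0 + s * exp (- (1 - s) * l) * G t1"
    if t: "t0 \<in> {0..1}" "t1 \<in> {0..1}" and s: "s \<in> {0<..<1}"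
      and g: "gauss_density lam (u t0) summable_on UNIV" "gauss_density lam (u t1) summable_on UNIV"
    for t0 t1 s l
  proof -
    let ?r = "(1 - s) * t0 + s * t1"
    have "?r \<in> closed_segment t0 t1" using s by (auto simp: closed_segment_def)
    moreover have "closed_segment t0 t1 \<subseteq> {0..1}"
      using t by (intro closed_segment_subset) auto
    ultimately have r: "?r \<in> {0..1}" by blast
    have nonneg: "0 \<le> (1 - s) * exp (s * l)" "0 \<le> s * exp (- (1 - s) * l)" using s by auto
    have le: "exp (?r * x) \<le> (1 - s) * exp (s * l) * exp (t0 * x) + s * exp (- (1 - s) * l) * exp (t1 * x)"
      for x using exp_convex_combination[of s "t0 * x" "t1 * x" l] s by (simp add: algebra_simps)
    note sm = solution_exp_density_summable[OF assms(2) _ u0]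
    show ?thesis
      using gauss_density_comparison[OF assms(1) nonneg sm[OF r] sm[OF t(1)] sm[OF t(2)]
          solution_exp_density_le[OF assms(2) u0 r t nonneg le] g]
      by (simp add: G_def)
  qed
  \<comment> \<open>Interior times are reached from the endpoints 0 and 1 with \<open>s = t\<close>;
    afterwards \<open>key\<close> applies to any two times.\<close>
  have summable: "gauss_density lam (u t) summable_on UNIV" if t: "t \<in> {0..1}" for t
  proof -
    consider "t = 0" | "t = 1" | "0 < t \<and> t < 1" using t by fastforce
    then show ?thesis
      by cases (use assms key[of 0 1 t] in auto)
  qed
  have G_nonneg: "0 \<le> G t" for t
    by (auto simp: G_def gauss_density_def intro: infsum_nonneg)
  have "G ((1 - s) * t0 + s * t1) \<le> G t0 powr (1 - s) * G t1 powr s"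
    if t: "t0 \<in> {0..1}" "t1 \<in> {0..1}" and s: "s \<in> {0<..<1}" for t0 t1 s
  \<comment> \<open>Both values are raised by \<open>e > 0\<close>, so that logarithms can be taken
    even where \<open>G\<close> vanishes; then \<open>e\<close> tends to 0.\<close>
  proof (rule tendsto_lowerbound)
    have lim: "((\<lambda>e. G t + e) \<longlongrightarrow> G t) (at_right 0)" for t
      using tendsto_add[OF tendsto_const tendsto_ident_at, of "G t" 0 "{0<..}"] by simp
    have ev: "\<forall>\<^sub>F e in at_right 0. 0 \<le> G t + e" for t
      by (rule eventually_mono[OF eventually_at_right_less]) (use G_nonneg[of t] in simp)
    \<comment> \<open>The exponents are positive, so the limit holds also when a base tends to
      0.\<close>
    show "((\<lambda>e. (G t0 + e) powr (1 - s) * (G t1 + e) powr s) \<longlongrightarrow> G t0 powr (1 - s) * G t1 powr s) (at_right 0)"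
      using s by (intro tendsto_mult tendsto_powr' lim tendsto_const) (simp_all add: ev)
    have "G ((1 - s) * t0 + s * t1) \<le> (G t0 + e) powr (1 - s) * (G t1 + e) powr s" if "e > 0" for e
    proof -
      define A B where "A = G t0 + e" and "B = G t1 + e"
      \<comment> \<open>The optimal parameter: \<open>s * l + ln A\<close> and
        \<open>- (1 - s) * l + ln B\<close> then coincide, the case of equality in the
        arithmetic-geometric mean inequality.\<close>
      define l where "l = ln B - ln A"
      have pos: "A > 0" "B > 0"
        using G_nonneg[of t0] G_nonneg[of t1] that by (auto simp: A_def B_def)
      have "G ((1 - s) * t0 + s * t1) \<le> (1 - s) * exp (s * l) * G t0 + s * exp (- (1 - s) * l) * G t1"
        using key[OF t s summable summable, OF t] by blast
      also have "\<dots> \<le> (1 - s) * exp (s * l) * A + s * exp (- (1 - s) * l) * B"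
        using s that by (intro add_mono mult_left_mono) (auto simp: A_def B_def)
      also have "\<dots> = (1 - s) * exp (s * l + ln A) + s * exp (- (1 - s) * l + ln B)"
        using pos by (simp add: exp_add)
      also have "\<dots> = exp ((1 - s) * ln A + s * ln B)"
        by (simp add: l_def algebra_simps)
      also have "\<dots> = A powr (1 - s) * B powr s"
        using pos by (simp add: powr_def exp_add)
      finally show ?thesis by (simp add: A_def B_def)
    qed
    then show "\<forall>\<^sub>F e in at_right 0. G ((1 - s) * t0 + s * t1) \<le> (G t0 + e) powr (1 - s) * (G t1 + e) powr s"
      by (rule eventually_mono[OF eventually_at_right_less])
  qed simp
  with summable G_nonneg show ?thesis
    by (auto simp: log_convex_unit_def G_def)
qed

end
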